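(* Let $x=(x_1,\ldots,x_n)$ and let $A(x)\in\mathbb{R}[x]^{m\times m}$ be a symmetric matrix polynomial whose entries are all forms of the same degree $d$ in $x$. Assume that $A(x)$ is positive definite. Then there exist a finite covering $\mathbb{R}^n=\bigcup_{i=1}^r S_i$ by semi-algebraic subsets $S_i$, integers $r_i\in\mathbb{N}$, forms $f_{i,j}(x)\in\mathbb{R}[x]$ and matrix polynomials $A_{i,j}(x)\in\mathbb{R}[x]^{m\times m}$ ($1\le i\le r$, $1\le j\le r_i$) such that for every $i$ $$\forall x\in S_i,\quad A(x)=\sum_{j=1}^{r_i} f_{i,j}(x)\,A_{i,j}(x)^T A_{i,j}(x),$$ and $f_{i,j}(x)\ge 0$ for all $x\in S_i$ and all $j$.
   Context: A form is a homogeneous polynomial (with real coefficients). A matrix polynomial is a matrix with entries in $\mathbb{R}[x]$. A symmetric matrix polynomial $A(x)=(a_{i,j}(x))\in\mathbb{R}[x]^{m\times m}$ whose entries are all forms of the same degree $d$ in $x=(x_1,\ldots,x_n)$ is called positive definite if $\sum_{i,j}a_{i,j}(x)y_iy_j>0$ for all $(x,y)\in S^{n-1}\times S^{m-1}$, where $S^{k-1}$ is the unit sphere of $\mathbb{R}^k$; equivalently, the real matrix $A(x)$ is positive definite for every $x\in\mathbb{R}^n\setminus\{0\}$. *)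

theory Defs
  imports "HOL-Analysis.Analysis" "HOL-Library.Poly_Mapping"
begin

(* Polynomials with real coefficients in finitely many variables indexed by 'n:
   an exponent vector is a finitely supported function from 'n to nat, and a polynomial is a
   finitely supported function from exponent vectors to reals. The (convolution) ring structure
   is the one provided by Poly_Mapping. *)
type_synonym 'n rpoly = "('n \<Rightarrow>\<^sub>0 nat) \<Rightarrow>\<^sub>0 real"

definition poly_eval :: "('n::finite) rpoly \<Rightarrow> real ^ 'n \<Rightarrow> real" where
  "poly_eval p x =
     (\<Sum>e\<in>Poly_Mapping.keys p. Poly_Mapping.lookup p e * (\<Prod>k\<in>UNIV. x $ k ^ Poly_Mapping.lookup e k))"

(* The zero polynomial is a form of every degree. *)
definition form_of_degree :: "nat \<Rightarrow> ('n::finite) rpoly \<Rightarrow> bool" where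
  "form_of_degree d p \<longleftrightarrow>
     (\<forall>e\<in>Poly_Mapping.keys p. (\<Sum>k\<in>UNIV. Poly_Mapping.lookup e k) = d)"

definition is_form :: "('n::finite) rpoly \<Rightarrow> bool" where
  "is_form p \<longleftrightarrow> (\<exists>d. form_of_degree d p)"

definition mat_eval :: "('n::finite) rpoly ^ 'm ^ 'm \<Rightarrow> real ^ 'n \<Rightarrow> real ^ 'm ^ 'm" where
  "mat_eval A x = (\<chi> i j. poly_eval (A $ i $ j) x)"

(* Intended for symmetric matrices of forms of one common degree, for which restricting to the
   unit spheres loses nothing. *)
definition positive_definite :: "('n::finite) rpoly ^ 'm ^ 'm \<Rightarrow> bool" where
  "positive_definite A \<longleftrightarrow>
     (\<forall>x\<in>sphere (0 :: real ^ 'n) 1. \<forall>y\<in>sphere (0 :: real ^ 'm) 1.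
        (\<Sum>i\<in>UNIV. \<Sum>j\<in>UNIV. poly_eval (A $ i $ j) x * y $ i * y $ j) > 0)"

(* The Boolean algebra of subsets of real n-space generated by the sets where p > 0. Sets given by
   p = 0 or p \<ge> 0 belong to it: the set where p \<ge> 0 is the complement of the set where - p > 0. *)
inductive semialgebraic :: "(real ^ 'n::finite) set \<Rightarrow> bool" where
  pos: "semialgebraic {x. poly_eval p x > 0}"
| compl: "semialgebraic S \<Longrightarrow> semialgebraic (- S)"
| union: "semialgebraic S \<Longrightarrow> semialgebraic T \<Longrightarrow> semialgebraic (S \<union> T)"
| inter: "semialgebraic S \<Longrightarrow> semialgebraic T \<Longrightarrow> semialgebraic (S \<inter> T)"

end

theory Submission
  imports Defs
begin

text \<open>
  The cone of positive semidefinite matrices is generated by the rank-one matrices \<open>v v\<^sup>T\<close>, and a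
  positive definite matrix \<open>M\<close> lies in the interior of that cone. This gives more than one
  decomposition of \<open>M\<close>: there are finitely many vectors \<open>v\<^sub>k\<close> and linear functionals \<open>l\<^sub>k\<close> on matrices,
  positive at \<open>M\<close>, such that every symmetric matrix \<open>N\<close> is the sum of the \<open>l\<^sub>k(N) v\<^sub>k v\<^sub>k\<^sup>T\<close>
  (lemma \<open>positive_definite_linear_decomposition\<close>).

  Apply this at \<open>M = A(u)\<close> for a unit vector \<open>u\<close>. The functions \<open>l\<^sub>k(A(x))\<close> are forms of degree \<open>d\<close>,
  because they are linear combinations of the entries of \<open>A\<close>. They satisfy the required identity for
  every \<open>x\<close>, and they are positive near \<open>u\<close>. So the identity is of the required kind on the
  semialgebraic set where all of them are nonnegative, and this set is a neighbourhood of \<open>u\<close>. Finitely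
  many such sets cover the unit sphere, which is compact. As the \<open>l\<^sub>k(A(x))\<close> are homogeneous, each of
  the sets is closed under multiplication by nonnegative scalars, and hence they cover the whole space.
\<close>

section \<open>Symmetric matrices as combinations of rank-one matrices\<close>

definition outer :: "real ^ 'm \<Rightarrow> real ^ 'm ^ 'm" where
  "outer v = (\<chi> i j. v $ i * v $ j)"

lemma quadratic_form_outer:
  fixes y w :: "real ^ 'm::finite"
  shows "y \<bullet> (outer w *v y) = (y \<bullet> w)\<^sup>2"
proof -
  have "outer w *v y = (y \<bullet> w) *\<^sub>R w"
    by (simp add: vec_eq_iff outer_def matrix_vector_mult_def inner_vec_def sum_distrib_left
        mult_ac)
  then show ?thesis
    by (simp add: power2_eq_square)
qed

lemma inner_matrix_vector_axis:
  fixes M :: "real ^ 'm::finite ^ 'm"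
  shows "axis i 1 \<bullet> (M *v axis j 1) = M $ i $ j"
  by (simp add: inner_axis' matrix_vector_mul_component) (simp add: inner_axis)

lemma symmetric_nth: "transpose M = M \<Longrightarrow> M $ i $ j = M $ j $ i"
  by (drule arg_cong[of _ _ "\<lambda>N. N $ i $ j"]) (simp add: transpose_def)

lemma symmetric_inner_swap:
  fixes M :: "real ^ 'm::finite ^ 'm"
  assumes "transpose M = M"
  shows "x \<bullet> (M *v y) = y \<bullet> (M *v x)"
  using assms by (metis dot_lmul_matrix inner_commute transpose_matrix_vector)

text \<open>Otherwise the quadratic form would be an affine function of \<open>t\<close> on the line \<open>e\<^sub>j + t e\<^sub>i\<close>, with
  slope \<open>2 M\<^sub>i\<^sub>j\<close>, and it would be bounded below.\<close>

lemma psd_diagonal_pos: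
  fixes M :: "real ^ 'm::finite ^ 'm"
  assumes sym: "transpose M = M" and psd: "\<And>y. y \<bullet> (M *v y) \<ge> 0" and nz: "M $ i $ j \<noteq> 0"
  shows "M $ i $ i > 0"
proof (rule ccontr)
  assume "\<not> M $ i $ i > 0"
  moreover have "M $ i $ i \<ge> 0"
    using psd[of "axis i 1"] by (simp add: inner_matrix_vector_axis)
  ultimately have z: "M $ i $ i = 0" by simp
  have s: "M $ j $ i = M $ i $ j"
    by (rule symmetric_nth[OF sym])
  define t where "t = - (M $ j $ j + 1) / (2 * M $ i $ j)"
  have "0 \<le> (axis j 1 + t *\<^sub>R axis i 1) \<bullet> (M *v (axis j 1 + t *\<^sub>R axis i 1))"
    by (rule psd)
  also have "\<dots> = M $ j $ j + 2 * t * M $ i $ j"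
    by (simp add: matrix_vector_right_distrib matrix_vector_mult_scaleR inner_add_left
        inner_add_right inner_matrix_vector_axis s z)
  also have "\<dots> = - 1"
    using nz by (simp add: t_def field_simps)
  finally show False by simp
qed

text \<open>This is Lagrange's completion of squares. If row \<open>i\<close> of \<open>M\<close> is not zero, subtract the rank-one
  matrix of \<open>w = M e\<^sub>i / sqrt M\<^sub>i\<^sub>i\<close>. The difference is still positive semidefinite, its row \<open>i\<close>
  vanishes, and the rows of \<open>M\<close> that were zero remain zero.\<close>

lemma psd_eq_sum_outer:
  fixes M :: "real ^ 'm::finite ^ 'm"
  assumes "transpose M = M" and "\<And>y. y \<bullet> (M *v y) \<ge> 0"
  shows "\<exists>vs. M = (\<Sum>v\<leftarrow>vs. outer v)"
  using assms
proof (induction "card {i. M $ i \<noteq> 0}" arbitrary: M rule: less_induct)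
  case less
  note sym = less.prems(1) and psd = less.prems(2)
  show ?case
  proof (cases "M = 0")
    case True
    then show ?thesis by (intro exI[of _ "[]"]) simp
  next
    case False
    then obtain i j where nz: "M $ i $ j \<noteq> 0"
      by (metis vec_eq_iff zero_index)
    have pos: "M $ i $ i > 0"
      by (rule psd_diagonal_pos[OF sym psd nz])
    have s: "M $ k $ l = M $ l $ k" for k l
      by (rule symmetric_nth[OF sym])
    define w where "w = (1 / sqrt (M $ i $ i)) *\<^sub>R (M *v axis i 1)"
    have w_nth: "w $ k = M $ k $ i / sqrt (M $ i $ i)" for k
      by (simp add: w_def matrix_vector_mul_component) (simp add: inner_axis)
    define M' where "M' = M - outer w"
    have M'_nth: "M' $ k $ l = M $ k $ l - M $ k $ i * M $ l $ i / M $ i $ i" for k l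
      using pos by (simp add: M'_def outer_def w_nth)
    have sym': "transpose M' = M'"
      by (simp add: vec_eq_iff transpose_def M'_nth s mult.commute)
    have psd': "y \<bullet> (M' *v y) \<ge> 0" for y
    proof -
      define a where "a = y \<bullet> (M *v axis i 1)"
      \<comment> \<open>The vector \<open>z\<close> is the part of \<open>y\<close> that is \<open>M\<close>-orthogonal to \<open>e\<^sub>i\<close>. The form of \<open>M\<close>
        takes at \<open>z\<close> the value that the form of \<open>M'\<close> takes at \<open>y\<close>.\<close>
      define z where "z = y - (a / M $ i $ i) *\<^sub>R axis i 1"
      have a': "axis i 1 \<bullet> (M *v y) = a"
        unfolding a_def by (rule symmetric_inner_swap[OF sym])
      have "0 \<le> z \<bullet> (M *v z)" by (rule psd)
      also have "z \<bullet> (M *v z) = y \<bullet> (M *v y) - a\<^sup>2 / M $ i $ i"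
        using pos
        by (simp add: z_def matrix_vector_mult_diff_distrib matrix_vector_mult_scaleR
            inner_diff_left inner_diff_right inner_matrix_vector_axis a' a_def[symmetric]
            power2_eq_square field_simps)
      also have "\<dots> = y \<bullet> (M' *v y)"
      proof -
        have "y \<bullet> w = a / sqrt (M $ i $ i)"
          by (simp add: w_def a_def)
        then have "(y \<bullet> w)\<^sup>2 = a\<^sup>2 / M $ i $ i"
          using pos by (simp add: power_divide)
        then show ?thesis
          by (simp add: M'_def matrix_vector_mult_diff_rdistrib inner_diff_right
              quadratic_form_outer)
      qed
      finally show ?thesis .
    qed
    have "{k. M' $ k \<noteq> 0} \<subset> {k. M $ k \<noteq> 0}"
    proof
      show "{k. M' $ k \<noteq> 0} \<subseteq> {k. M $ k \<noteq> 0}"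
      proof clarify
        fix k assume "M' $ k \<noteq> 0" "M $ k = 0"
        moreover from this(2) have "M' $ k = 0"
          by (simp add: vec_eq_iff M'_nth)
        ultimately show False by simp
      qed
      have "M' $ i $ l = 0" for l
        using pos s[of l i] by (simp add: M'_nth)
      then have "M' $ i = 0"
        by (simp add: vec_eq_iff)
      moreover have "M $ i \<noteq> 0"
        using nz by (metis zero_index)
      ultimately show "{k. M' $ k \<noteq> 0} \<noteq> {k. M $ k \<noteq> 0}" by blast
    qed
    then have "card {k. M' $ k \<noteq> 0} < card {k. M $ k \<noteq> 0}"
      by (intro psubset_card_mono) auto
    then obtain vs where "M' = (\<Sum>v\<leftarrow>vs. outer v)"
      using less.hyps[OF _ sym' psd'] by blast
    then have "M = (\<Sum>v\<leftarrow>w # vs. outer v)"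
      by (simp add: M'_def algebra_simps)
    then show ?thesis by blast
  qed
qed

lemma positive_definite_minus_scaled_identity:
  fixes M :: "real ^ 'm::finite ^ 'm"
  assumes pd: "\<And>y. norm y = 1 \<Longrightarrow> y \<bullet> (M *v y) > 0"
  shows "\<exists>\<epsilon>>0. \<forall>y. y \<bullet> ((M - \<epsilon> *\<^sub>R mat 1) *v y) \<ge> 0"
proof -
  have "continuous_on (sphere 0 1) (\<lambda>y. y \<bullet> (M *v y))"
    by (intro continuous_intros linear_continuous_on matrix_vector_mul_bounded_linear)
  moreover have "axis undefined 1 \<in> sphere (0 :: real ^ 'm) 1"
    by (simp add: norm_axis_1)
  ultimately obtain y0 :: "real ^ 'm" where y0: "norm y0 = 1"
    and least: "\<And>y. norm y = 1 \<Longrightarrow> y0 \<bullet> (M *v y0) \<le> y \<bullet> (M *v y)"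
    using continuous_attains_inf[OF compact_sphere, of 0 1 "\<lambda>y. y \<bullet> (M *v y)"] by fastforce
  define \<epsilon> where "\<epsilon> = y0 \<bullet> (M *v y0)"
  have "y \<bullet> ((M - \<epsilon> *\<^sub>R mat 1) *v y) \<ge> 0" for y
  proof (cases "y = 0")
    case False
    define u where "u = (1 / norm y) *\<^sub>R y"
    have y: "y = norm y *\<^sub>R u" and u: "norm u = 1"
      using False by (simp_all add: u_def)
    have "y \<bullet> (M *v y) = (norm y)\<^sup>2 * (u \<bullet> (M *v u))"
      by (subst (1 2) y) (simp add: matrix_vector_mult_scaleR power2_eq_square)
    moreover have "\<epsilon> \<le> u \<bullet> (M *v u)"
      unfolding \<epsilon>_def by (rule least[OF u])
    ultimately have "\<epsilon> * (norm y)\<^sup>2 \<le> y \<bullet> (M *v y)"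
      by (simp add: mult.commute mult_right_mono)
    then show ?thesis
      by (simp add: matrix_vector_mult_diff_rdistrib scaleR_matrix_vector_assoc[symmetric]
          inner_diff_right power2_norm_eq_inner)
  qed simp
  moreover have "\<epsilon> > 0"
    unfolding \<epsilon>_def by (rule pd[OF y0])
  ultimately show ?thesis by blast
qed

text \<open>This is the identity that turns a small symmetric perturbation of a multiple of the identity
  matrix into a nonnegative combination of rank-one matrices. It rests on
  \<open>(e\<^sub>i + e\<^sub>j)(e\<^sub>i + e\<^sub>j)\<^sup>T - (e\<^sub>i - e\<^sub>j)(e\<^sub>i - e\<^sub>j)\<^sup>T = 2 (e\<^sub>i e\<^sub>j\<^sup>T + e\<^sub>j e\<^sub>i\<^sup>T)\<close>; the two
  rank-one matrices on the left add up to \<open>2 (e\<^sub>i e\<^sub>i\<^sup>T + e\<^sub>j e\<^sub>j\<^sup>T)\<close>, and the sum of the latter over all pairs is a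
  multiple of the identity matrix. The coefficients are nonnegative as soon as all \<open>\<bar>E\<^sub>i\<^sub>j\<bar>\<close> are
  at most \<open>\<delta>\<close>.\<close>

lemma perturbed_identity_eq_sum_outer:
  fixes E :: "real ^ 'm::finite ^ 'm" and \<delta> :: real
  assumes sym: "transpose E = E"
  shows "E + (\<delta> * CARD('m)) *\<^sub>R mat 1 =
    (\<Sum>(i, j)\<in>UNIV. ((\<delta> + E $ i $ j) / 4) *\<^sub>R outer (axis i 1 + axis j 1)
                 + ((\<delta> - E $ i $ j) / 4) *\<^sub>R outer (axis i 1 - axis j 1))"
    (is "?L = ?R")
proof -
  have s: "E $ k $ l = E $ l $ k" for k l
    by (rule symmetric_nth[OF sym])
  let ?a = "\<lambda>i k. (if i = k then 1 else 0) :: real"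
  have pick: "(\<Sum>i\<in>UNIV. \<Sum>j\<in>UNIV. h i j * (?a i k * ?a j l)) = h k l"
    for h :: "'m \<Rightarrow> 'm \<Rightarrow> real" and k l
  proof -
    have "(\<Sum>i\<in>UNIV. \<Sum>j\<in>UNIV. h i j * (?a i k * ?a j l))
        = (\<Sum>i\<in>UNIV. if i = k then (\<Sum>j\<in>UNIV. if j = l then h i j else 0) else 0)"
    proof (intro sum.cong refl)
      fix i
      show "(\<Sum>j\<in>UNIV. h i j * (?a i k * ?a j l))
          = (if i = k then (\<Sum>j\<in>UNIV. if j = l then h i j else 0) else 0)"
        by (cases "i = k") (simp_all add: if_distrib[of "\<lambda>x. _ * x"] cong: if_cong)
    qed
    then show ?thesis by simp
  qed
  have "?R $ k $ l = ?L $ k $ l" for k l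
  proof -
    have "?R $ k $ l = (\<Sum>(i, j)\<in>UNIV.
        (\<delta> + E $ i $ j) / 4 * ((?a i k + ?a j k) * (?a i l + ?a j l))
      + (\<delta> - E $ i $ j) / 4 * ((?a i k - ?a j k) * (?a i l - ?a j l)))"
      by (simp add: outer_def axis_def case_prod_unfold eq_commute)
    also have "\<dots> = (\<Sum>i\<in>UNIV. \<Sum>j\<in>UNIV.
        \<delta> / 2 * (?a i k * ?a i l) + \<delta> / 2 * (?a j k * ?a j l)
      + E $ i $ j / 2 * (?a i k * ?a j l) + E $ i $ j / 2 * (?a i l * ?a j k))"
      by (simp add: sum.cartesian_product UNIV_Times_UNIV[symmetric] del: UNIV_Times_UNIV)
        (intro sum.cong refl, simp add: case_prod_unfold field_simps)
    also have "\<dots> = \<delta> * CARD('m) * ?a k l + E $ k $ l / 2 + E $ l $ k / 2"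
    proof -
      have "(\<Sum>i\<in>UNIV. \<delta> / 2 * (?a i k * ?a i l))
          = (\<Sum>i\<in>UNIV. if i = k then \<delta> / 2 * ?a k l else 0)"
        by (intro sum.cong) auto
      then have "(\<Sum>i\<in>UNIV. \<delta> / 2 * (?a i k * ?a i l)) = \<delta> / 2 * ?a k l"
        by simp
      then show ?thesis
        unfolding sum.distrib pick
        by (simp only: sum_constant sum_distrib_left[symmetric]) (simp add: field_simps)
    qed
    also have "\<dots> = ?L $ k $ l"
      by (simp add: mat_def s[of l k])
    finally show ?thesis .
  qed
  then show ?thesis by (simp add: vec_eq_iff)
qed

text \<open>Choose \<open>\<epsilon>\<close> such that \<open>M - \<epsilon> I\<close> is positive semidefinite, hence a sum of rank-one matrices. Let
  \<open>\<lambda>(N)\<close> be the coefficient of the orthogonal projection of \<open>N\<close> onto the line of \<open>M\<close>. Then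
  \<open>N = (N - \<lambda>(N) M + \<lambda>(N) \<epsilon> I) + \<lambda>(N) (M - \<epsilon> I)\<close>. The first summand is a perturbation of a multiple
  of the identity matrix, and all coefficients depend linearly on \<open>N\<close>; this is why \<open>M\<close> is scaled
  by \<open>\<lambda>(N)\<close>. At \<open>N = M\<close> we have \<open>\<lambda> = 1\<close> and no perturbation, so the coefficients are positive there.
  A linear functional is represented by its inner product with a matrix \<open>G\<close>.\<close>

lemma positive_definite_linear_decomposition:
  fixes M :: "real ^ 'm::finite ^ 'm"
  assumes sym: "transpose M = M" and pd: "\<And>y. norm y = 1 \<Longrightarrow> y \<bullet> (M *v y) > 0"
  shows "\<exists>L. (\<forall>(G, v)\<in>set L. M \<bullet> G > 0) \<and>
    (\<forall>N. transpose N = N \<longrightarrow> N = (\<Sum>(G, v)\<leftarrow>L. (N \<bullet> G) *\<^sub>R outer v))"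
proof -
  obtain \<epsilon> where \<epsilon>: "\<epsilon> > 0" and psd: "\<And>y. y \<bullet> ((M - \<epsilon> *\<^sub>R mat 1) *v y) \<ge> 0"
    using positive_definite_minus_scaled_identity[OF pd] by blast
  have "transpose (M - \<epsilon> *\<^sub>R mat 1) = M - \<epsilon> *\<^sub>R mat 1"
    using sym by (auto simp: vec_eq_iff transpose_def mat_def)
  then obtain vs where vs: "M - \<epsilon> *\<^sub>R mat 1 = (\<Sum>v\<leftarrow>vs. outer v)"
    using psd_eq_sum_outer psd by blast
  have "M \<noteq> 0"
    using pd[of "axis undefined 1"] by (auto simp: norm_axis_1)
  then have MM: "M \<bullet> M > 0" by simp
  define P where "P = (1 / (M \<bullet> M)) *\<^sub>R M"
  have MP: "M \<bullet> P = 1"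
    using MM by (simp add: P_def)
  define \<delta> where "\<delta> = \<epsilon> / CARD('m)"
  have \<delta>: "\<delta> > 0" "\<epsilon> = \<delta> * CARD('m)"
    using \<epsilon> by (simp_all add: \<delta>_def)
  define G where "G s i j = (1 / 4) *\<^sub>R (\<delta> *\<^sub>R P + s *\<^sub>R (axis i (axis j 1) - M $ i $ j *\<^sub>R P))"
    for s i j
  have G: "N \<bullet> G s i j = (\<delta> * (N \<bullet> P) + s * (N - (N \<bullet> P) *\<^sub>R M) $ i $ j) / 4" for N s i j
    by (simp add: G_def inner_add_right inner_diff_right inner_axis)
  obtain ps :: "('m \<times> 'm) list" where ps: "set ps = UNIV" "distinct ps"
    using finite_distinct_list[OF finite_class.finite_UNIV] by blast
  define L where "L = map (\<lambda>(i, j). (G 1 i j, axis i 1 + axis j 1)) ps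
    @ map (\<lambda>(i, j). (G (- 1) i j, axis i 1 - axis j 1)) ps @ map (\<lambda>v. (P, v)) vs"
  have "\<forall>(K, v)\<in>set L. M \<bullet> K > 0"
    using \<delta>(1) by (auto simp: L_def G MP)
  moreover have "\<forall>N. transpose N = N \<longrightarrow> N = (\<Sum>(K, v)\<leftarrow>L. (N \<bullet> K) *\<^sub>R outer v)"
  proof (intro allI impI)
    fix N :: "real ^ 'm ^ 'm"
    assume N: "transpose N = N"
    let ?c = "N \<bullet> P"
    define E where "E = N - ?c *\<^sub>R M"
    have E: "transpose E = E"
      using sym N by (simp add: E_def vec_eq_iff transpose_def)
    have ps_sum: "(\<Sum>(i, j)\<leftarrow>ps. h i j) = (\<Sum>(i, j)\<in>UNIV. h i j)"
      for h :: "'m \<Rightarrow> 'm \<Rightarrow> real ^ 'm ^ 'm"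
      using ps sum_list_distinct_conv_sum_set[of ps "\<lambda>(i, j). h i j"] by simp
    have "(\<Sum>(K, v)\<leftarrow>L. (N \<bullet> K) *\<^sub>R outer v) =
        (\<Sum>(i, j)\<leftarrow>ps. (N \<bullet> G 1 i j) *\<^sub>R outer (axis i 1 + axis j 1))
      + (\<Sum>(i, j)\<leftarrow>ps. (N \<bullet> G (- 1) i j) *\<^sub>R outer (axis i 1 - axis j 1))
      + (\<Sum>v\<leftarrow>vs. ?c *\<^sub>R outer v)"
      by (simp add: L_def comp_def case_prod_unfold add.assoc)
    also have "(\<Sum>v\<leftarrow>vs. ?c *\<^sub>R outer v) = ?c *\<^sub>R (M - \<epsilon> *\<^sub>R mat 1)"
      unfolding vs by (induction vs) (simp_all add: scaleR_add_right)
    also have "(\<Sum>(i, j)\<leftarrow>ps. (N \<bullet> G 1 i j) *\<^sub>R outer (axis i 1 + axis j 1))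
      + (\<Sum>(i, j)\<leftarrow>ps. (N \<bullet> G (- 1) i j) *\<^sub>R outer (axis i 1 - axis j 1))
      = E + (\<delta> * ?c * CARD('m)) *\<^sub>R mat 1"
      unfolding ps_sum perturbed_identity_eq_sum_outer[OF E, of "\<delta> * ?c"]
      by (simp add: sum.distrib case_prod_unfold G E_def add_diff_eq diff_diff_eq2)
    also have "E + (\<delta> * ?c * CARD('m)) *\<^sub>R mat 1 + ?c *\<^sub>R (M - \<epsilon> *\<^sub>R mat 1) = N"
      by (simp add: E_def \<delta>(2) scaleR_diff_right mult_ac)
    finally show "N = (\<Sum>(K, v)\<leftarrow>L. (N \<bullet> K) *\<^sub>R outer v)" by (rule HOL.sym)
  qed
  ultimately show ?thesis by (intro exI[of _ L] conjI)
qed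

section \<open>Evaluation of polynomials and forms\<close>

lemma poly_eval_superset:
  assumes "finite K" "Poly_Mapping.keys p \<subseteq> K"
  shows "poly_eval p x =
    (\<Sum>e\<in>K. Poly_Mapping.lookup p e * (\<Prod>k\<in>UNIV. x $ k ^ Poly_Mapping.lookup e k))"
  unfolding poly_eval_def using assms
  by (intro sum.mono_neutral_left) (auto simp: in_keys_iff)

lemma poly_eval_add: "poly_eval (p + q) x = poly_eval p x + poly_eval q x"
proof -
  let ?K = "Poly_Mapping.keys p \<union> Poly_Mapping.keys q"
  show ?thesis
    using keys_add[of p q]
    by (simp add: poly_eval_superset[of ?K] lookup_add distrib_right sum.distrib)
qed

lemma poly_eval_zero [simp]: "poly_eval 0 x = 0"
  by (simp add: poly_eval_def)

lemma poly_eval_uminus: "poly_eval (- p) x = - poly_eval p x"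
  using poly_eval_add[of p "- p" x] by simp

lemma poly_eval_sum: "poly_eval (sum p I) x = (\<Sum>i\<in>I. poly_eval (p i) x)"
  by (induction I rule: infinite_finite_induct) (simp_all add: poly_eval_add)

lemma poly_eval_const: "poly_eval (Poly_Mapping.single 0 c) x = c"
  by (simp add: poly_eval_superset[of "{0}"])

lemma lookup_scale:
  "Poly_Mapping.lookup (Poly_Mapping.map ((*) c) p) e = c * Poly_Mapping.lookup p e" for c :: real
  by (simp add: Poly_Mapping.map.rep_eq when_def)

lemma poly_eval_scale: "poly_eval (Poly_Mapping.map ((*) c) p) x = c * poly_eval p x"
proof -
  have "Poly_Mapping.keys (Poly_Mapping.map ((*) c) p) \<subseteq> Poly_Mapping.keys p"
    by (auto simp: in_keys_iff lookup_scale)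
  then show ?thesis
    by (simp add: poly_eval_superset[of "Poly_Mapping.keys p"] lookup_scale sum_distrib_left
        mult.assoc)
qed

lemma form_of_degree_scale:
  "form_of_degree d p \<Longrightarrow> form_of_degree d (Poly_Mapping.map ((*) c) p)"
  by (auto simp: form_of_degree_def in_keys_iff lookup_scale)

lemma form_of_degree_sum:
  "(\<And>i. i \<in> I \<Longrightarrow> form_of_degree d (p i)) \<Longrightarrow> form_of_degree d (sum p I)"
proof (induction I rule: infinite_finite_induct)
  case (insert i I)
  then show ?case
    using keys_add[of "p i" "sum p I"] by (auto simp: form_of_degree_def)
qed (simp_all add: form_of_degree_def)

text \<open>For \<open>t = 0\<close> this relies on \<open>0 ^ 0 = 1\<close>; forms of degree zero are constant.\<close>

lemma poly_eval_homogeneous: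
  assumes "form_of_degree d p"
  shows "poly_eval p (t *\<^sub>R x) = t ^ d * poly_eval p x"
proof -
  have "(\<Prod>k\<in>UNIV. (t *\<^sub>R x) $ k ^ Poly_Mapping.lookup e k)
      = t ^ d * (\<Prod>k\<in>UNIV. x $ k ^ Poly_Mapping.lookup e k)"
    if "e \<in> Poly_Mapping.keys p" for e
    using assms that
    by (auto simp: form_of_degree_def power_mult_distrib prod.distrib power_sum[symmetric])
  then show ?thesis
    by (simp add: poly_eval_def sum_distrib_left mult_ac)
qed

lemma continuous_on_poly_eval: "continuous_on S (poly_eval p)"
  unfolding poly_eval_def by (intro continuous_intros)

definition entry_combination :: "real ^ 'm ^ 'm \<Rightarrow> ('n::finite) rpoly ^ 'm::finite ^ 'm \<Rightarrow> 'n rpoly"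
  where "entry_combination G A = (\<Sum>i\<in>UNIV. \<Sum>j\<in>UNIV. Poly_Mapping.map ((*) (G $ i $ j)) (A $ i $ j))"

lemma poly_eval_entry_combination:
  "poly_eval (entry_combination G A) x = mat_eval A x \<bullet> G"
  by (simp add: entry_combination_def poly_eval_sum poly_eval_scale inner_vec_def mat_eval_def
      mult.commute)

lemma form_of_degree_entry_combination:
  "(\<And>i j. form_of_degree d (A $ i $ j)) \<Longrightarrow> form_of_degree d (entry_combination G A)"
  by (simp add: entry_combination_def form_of_degree_sum form_of_degree_scale)

lemma outer_eq_constant_gram:
  fixes v :: "real ^ 'm::finite"
  shows "\<exists>B :: ('n::finite) rpoly ^ 'm ^ 'm.
    \<forall>x. transpose (mat_eval B x) ** mat_eval B x = outer v"
proof -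
  \<comment> \<open>One row is \<open>v\<close> and the other rows vanish; which row carries \<open>v\<close> is immaterial.\<close>
  define B :: "'n rpoly ^ 'm ^ 'm" where
    "B = (\<chi> k l. if k = undefined then Poly_Mapping.single 0 (v $ l) else 0)"
  have "mat_eval B x = (\<chi> k l. if k = undefined then v $ l else 0)" for x
    by (simp add: mat_eval_def B_def vec_eq_iff poly_eval_const)
  then have "transpose (mat_eval B x) ** mat_eval B x = outer v" for x
    by (simp add: matrix_matrix_mult_def transpose_def outer_def vec_eq_iff
        if_distrib[of "\<lambda>x. _ * x"] if_distribR cong: if_cong)
  then show ?thesis by blast
qed

section \<open>Semialgebraic sets\<close>

lemma semialgebraic_nonneg: "semialgebraic {x. poly_eval p x \<ge> 0}"
proof -
  have "{x. poly_eval p x \<ge> 0} = - {x. poly_eval (- p) x > 0}"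
    by (auto simp: poly_eval_uminus)
  then show ?thesis
    using semialgebraic.compl[OF semialgebraic.pos] by simp
qed

lemma semialgebraic_all_nonneg: "semialgebraic {x. \<forall>p\<in>set ps. poly_eval p x \<ge> 0}"
proof (induction ps)
  case Nil
  show ?case
    using semialgebraic_nonneg[of 0] by simp
next
  case (Cons p ps)
  have "{x. \<forall>q\<in>set (p # ps). poly_eval q x \<ge> 0}
      = {x. poly_eval p x \<ge> 0} \<inter> {x. \<forall>q\<in>set ps. poly_eval q x \<ge> 0}" by auto
  then show ?case
    using semialgebraic.inter[OF semialgebraic_nonneg Cons.IH] by simp
qed

section \<open>Covering of the space\<close>

lemma sum_list_eq_sum_from_1: "(\<Sum>a\<leftarrow>L. g a) = (\<Sum>j=1..length L. g (L ! (j - 1)))"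
  by (simp add: sum_list_sum_nth sum.atLeast1_atMost_eq atLeast0LessThan)

text \<open>Compactness of the sphere is applied to the open sets where the forms of the local
  decompositions are positive. Homogeneity carries the nonnegativity of these forms from the unit
  vector of \<open>x\<close> to \<open>x\<close> itself.\<close>

lemma finite_conic_decompositions:
  fixes A :: "('n::finite) rpoly ^ 'm::finite ^ 'm"
  assumes sym: "transpose A = A"
    and form: "\<And>i j. form_of_degree d (A $ i $ j)"
    and pd: "positive_definite A"
  shows "\<exists>Ls. (\<forall>L\<in>set Ls. \<forall>x. mat_eval A x = (\<Sum>(G, v)\<leftarrow>L. (mat_eval A x \<bullet> G) *\<^sub>R outer v)) \<and>
    (\<forall>x. \<exists>L\<in>set Ls. \<forall>(G, v)\<in>set L. mat_eval A x \<bullet> G \<ge> 0)"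
proof -
  have symx: "transpose (mat_eval A x) = mat_eval A x" for x
  proof -
    have "A $ i $ j = A $ j $ i" for i j
      by (rule symmetric_nth[OF sym])
    then show ?thesis
      by (simp add: transpose_def mat_eval_def vec_eq_iff)
  qed
  have quad: "y \<bullet> (mat_eval A u *v y) > 0" if "norm u = 1" "norm y = 1" for u y
  proof -
    have "y \<bullet> (mat_eval A u *v y)
        = (\<Sum>i\<in>UNIV. \<Sum>j\<in>UNIV. poly_eval (A $ i $ j) u * y $ i * y $ j)"
      by (simp add: inner_vec_def matrix_vector_mult_def mat_eval_def sum_distrib_left mult_ac)
    then show ?thesis
      using pd that by (simp add: positive_definite_def)
  qed
  have "\<forall>u\<in>sphere (0 :: real ^ 'n) 1. \<exists>L. (\<forall>(G, v)\<in>set L. mat_eval A u \<bullet> G > 0) \<and>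
      (\<forall>N. transpose N = N \<longrightarrow> N = (\<Sum>(G, v)\<leftarrow>L. (N \<bullet> G) *\<^sub>R outer v))"
    by (intro ballI positive_definite_linear_decomposition symx quad) simp_all
  from bchoice[OF this] obtain L where
    L: "\<forall>u\<in>sphere 0 1. (\<forall>(G, v)\<in>set (L u). mat_eval A u \<bullet> G > 0) \<and>
      (\<forall>N. transpose N = N \<longrightarrow> N = (\<Sum>(G, v)\<leftarrow>L u. (N \<bullet> G) *\<^sub>R outer v))"
    by (elim exE)
  have Lpos: "\<forall>(G, v)\<in>set (L u). mat_eval A u \<bullet> G > 0" if "u \<in> sphere 0 1" for u
    by (rule bspec[OF L that, THEN conjunct1])
  have Leq: "N = (\<Sum>(G, v)\<leftarrow>L u. (N \<bullet> G) *\<^sub>R outer v)"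
    if "u \<in> sphere 0 1" "transpose N = N" for u N
    by (rule bspec[OF L that(1), THEN conjunct2, THEN spec, THEN mp, OF that(2)])
  define U where "U u = (\<Inter>(G, v)\<in>set (L u). {x. mat_eval A x \<bullet> G > 0})" for u
  have "open {x. mat_eval A x \<bullet> G > 0}" for G
    using open_Collect_less[OF continuous_on_const continuous_on_poly_eval,
        of 0 "entry_combination G A"]
    by (simp add: poly_eval_entry_combination)
  then have "open (U u)" for u
    unfolding U_def by (intro open_INT) auto
  moreover have "sphere 0 1 \<subseteq> (\<Union>u\<in>sphere 0 1. U u)"
    using Lpos by (fastforce simp: U_def)
  ultimately obtain T where T: "T \<subseteq> sphere 0 1" "finite T" "sphere 0 1 \<subseteq> (\<Union>u\<in>T. U u)"
    using compactE_image[OF compact_sphere, of "sphere 0 1" U] by metis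
  obtain us where us: "set us = T"
    using finite_list[OF T(2)] by blast
  have "\<forall>x. \<exists>K\<in>set (map L us). \<forall>(G, v)\<in>set K. mat_eval A x \<bullet> G \<ge> 0"
  proof
    fix x :: "real ^ 'n"
    \<comment> \<open>The origin has no direction of its own; any unit vector will do.\<close>
    define w where "w = (if x = 0 then axis undefined 1 else (1 / norm x) *\<^sub>R x)"
    have w: "w \<in> sphere 0 1" "x = norm x *\<^sub>R w"
      by (auto simp: w_def norm_axis_1)
    then obtain u where u: "u \<in> T" "w \<in> U u"
      using T(3) by blast
    have "mat_eval A x \<bullet> G \<ge> 0" if "(G, v) \<in> set (L u)" for G v
    proof -
      have "mat_eval A x \<bullet> G = norm x ^ d * (mat_eval A w \<bullet> G)"
        using poly_eval_homogeneous[OF form_of_degree_entry_combination[OF form], of G "norm x" w]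
          w(2) by (simp add: poly_eval_entry_combination)
      moreover have "mat_eval A w \<bullet> G > 0"
        using u(2) that by (auto simp: U_def)
      ultimately show ?thesis by simp
    qed
    then show "\<exists>K\<in>set (map L us). \<forall>(G, v)\<in>set K. mat_eval A x \<bullet> G \<ge> 0"
      using u(1) us by (intro bexI[of _ "L u"]) auto
  qed
  moreover have "\<forall>K\<in>set (map L us). \<forall>x. mat_eval A x = (\<Sum>(G, v)\<leftarrow>K. (mat_eval A x \<bullet> G) *\<^sub>R outer v)"
  proof (intro ballI allI)
    fix K x assume "K \<in> set (map L us)"
    then obtain u where u: "u \<in> sphere 0 1" and K: "K = L u"
      using us T(1) by auto
    show "mat_eval A x = (\<Sum>(G, v)\<leftarrow>K. (mat_eval A x \<bullet> G) *\<^sub>R outer v)"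
      unfolding K by (rule Leq[OF u symx])
  qed
  ultimately show ?thesis
    by (intro exI[of _ "map L us"] conjI)
qed

theorem theorem4p1:
  fixes A :: "('n::finite) rpoly ^ 'm::finite ^ 'm" and d :: nat
  assumes "transpose A = A"
    and "\<And>i j. form_of_degree d (A $ i $ j)"
    and "positive_definite A"
  shows "\<exists>(r :: nat) (S :: nat \<Rightarrow> (real ^ 'n) set) (rr :: nat \<Rightarrow> nat)
           (f :: nat \<Rightarrow> nat \<Rightarrow> 'n rpoly) (B :: nat \<Rightarrow> nat \<Rightarrow> 'n rpoly ^ 'm ^ 'm).
           (\<Union>i\<in>{1..r}. S i) = UNIV \<and>
           (\<forall>i\<in>{1..r}. semialgebraic (S i)) \<and>
           (\<forall>i\<in>{1..r}. \<forall>j\<in>{1..rr i}. is_form (f i j)) \<and>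
           (\<forall>i\<in>{1..r}. \<forall>x\<in>S i.
              mat_eval A x =
                (\<Sum>j=1..rr i. poly_eval (f i j) x *\<^sub>R
                   (transpose (mat_eval (B i j) x) ** mat_eval (B i j) x)) \<and>
              (\<forall>j\<in>{1..rr i}. poly_eval (f i j) x \<ge> 0))"
proof -
  obtain Ls where
    eq: "\<forall>L\<in>set Ls. \<forall>x. mat_eval A x = (\<Sum>(G, v)\<leftarrow>L. (mat_eval A x \<bullet> G) *\<^sub>R outer v)" and
    cover: "\<forall>x. \<exists>L\<in>set Ls. \<forall>(G, v)\<in>set L. mat_eval A x \<bullet> G \<ge> 0"
    using finite_conic_decompositions[OF assms] by (elim exE conjE) (rule that)
  obtain R :: "real ^ 'm \<Rightarrow> 'n rpoly ^ 'm ^ 'm" where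
    R: "\<And>v x. transpose (mat_eval (R v) x) ** mat_eval (R v) x = outer v"
    using outer_eq_constant_gram by metis
  define rr where "rr i = length (Ls ! (i - 1))" for i
  define f where "f i j = entry_combination (fst (Ls ! (i - 1) ! (j - 1))) A" for i j
  define B where "B i j = R (snd (Ls ! (i - 1) ! (j - 1)))" for i j
  define S where
    "S i = {x. \<forall>p\<in>set (map (\<lambda>(G, v). entry_combination G A) (Ls ! (i - 1))). poly_eval p x \<ge> 0}"
    for i
  have S_iff: "x \<in> S i \<longleftrightarrow> (\<forall>(G, v)\<in>set (Ls ! (i - 1)). mat_eval A x \<bullet> G \<ge> 0)" for x i
    by (auto simp: S_def poly_eval_entry_combination)
  have "\<exists>i\<in>{1..length Ls}. x \<in> S i" for x
  proof -
    obtain L where L: "L \<in> set Ls" "\<forall>(G, v)\<in>set L. mat_eval A x \<bullet> G \<ge> 0"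
      using cover by blast
    then obtain k where "k < length Ls" "Ls ! k = L"
      by (auto simp: in_set_conv_nth)
    then show ?thesis
      using L(2) by (intro bexI[of _ "Suc k"]) (auto simp: S_iff)
  qed
  then have covering: "(\<Union>i\<in>{1..length Ls}. S i) = UNIV" by blast
  have semialg: "\<forall>i\<in>{1..length Ls}. semialgebraic (S i)"
    unfolding S_def by (intro ballI semialgebraic_all_nonneg)
  have forms: "\<forall>i\<in>{1..length Ls}. \<forall>j\<in>{1..rr i}. is_form (f i j)"
    unfolding is_form_def f_def using form_of_degree_entry_combination[OF assms(2)] by blast
  have identity: "mat_eval A x = (\<Sum>j=1..rr i. poly_eval (f i j) x *\<^sub>R
      (transpose (mat_eval (B i j) x) ** mat_eval (B i j) x))"
    if "i \<in> {1..length Ls}" for i x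
  proof -
    have "Ls ! (i - 1) \<in> set Ls"
      using that by (intro nth_mem) auto
    then have "mat_eval A x = (\<Sum>(G, v)\<leftarrow>Ls ! (i - 1). (mat_eval A x \<bullet> G) *\<^sub>R outer v)"
      by (rule eq[rule_format])
    also have "\<dots> = (\<Sum>j=1..rr i. poly_eval (f i j) x *\<^sub>R
        (transpose (mat_eval (B i j) x) ** mat_eval (B i j) x))"
      by (simp add: sum_list_eq_sum_from_1 rr_def f_def B_def R poly_eval_entry_combination
          case_prod_unfold)
    finally show ?thesis .
  qed
  have nonneg: "poly_eval (f i j) x \<ge> 0" if "x \<in> S i" "j \<in> {1..rr i}" for i j x
  proof -
    have "Ls ! (i - 1) ! (j - 1) \<in> set (Ls ! (i - 1))"
      using that(2) by (intro nth_mem) (auto simp: rr_def)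
    then show ?thesis
      using that(1) by (auto simp: S_iff f_def poly_eval_entry_combination)
  qed
  have locally: "\<forall>i\<in>{1..length Ls}. \<forall>x\<in>S i.
      mat_eval A x = (\<Sum>j=1..rr i. poly_eval (f i j) x *\<^sub>R
        (transpose (mat_eval (B i j) x) ** mat_eval (B i j) x)) \<and>
      (\<forall>j\<in>{1..rr i}. poly_eval (f i j) x \<ge> 0)"
    by (intro ballI conjI identity nonneg)
  show ?thesis
    by (rule exI[of _ "length Ls"], rule exI[of _ S], rule exI[of _ rr], rule exI[of _ f],
        rule exI[of _ B]) (intro conjI covering semialg forms locally)
qed

end
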